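(* Let $p\ge 2$ be an integer and let $\phi$ be a diophantine inequality, i.e. a positive $L_p$-formula. If there exist approximations $\sigma,\pi$ to the sum and product such that $\phi$ is unsolvable over the coarse interpretation based on $\sigma$ and $\pi$, i.e. $\phi^{\mathfrak{C}_{\sigma,\pi}}$ is the bottom element of $L_p/Z$, then $\phi$ is unsolvable in the standard sense, i.e. no assignment of integers to the variables satisfies $\phi$ in the standard interpretation.
   Context: Languages. Fix an integer $p\ge 2$ (not necessarily prime). $L_p^{min}$ is the first-order language with a numeral for each natural number, a unary function symbol $-$, unary relation symbols $R_0,\dots,R_{p-1}$, and binary relation symbols $<$ and $=$. $L_p$ is $L_p^{min}$ expanded with binary function symbols $+$ and $\cdot$. The standard interpretation has domain $\mathbb{Z}$, with numerals, $-$, $<$, $=$, $+$, $\cdot$ having their usual meaning and $R_a$ denoting $\{n\in\mathbb{Z} : n\equiv a \pmod p\}$. The symbols $\le,>,\ge$ are abbreviations derived from $<$ and $=$. A formula is positive if its only connectives and quantifiers are among $\vee,\wedge,\forall,\exists$. A (system of) diophantine inequalities is a positive $L_p$-formula. Lindenbaum algebra. $Z$ is the set of $L_p$-formulas true in the standard interpretation under every assignment of integers to the variables. $L_p/Z$ is the set of equivalence classes $[\phi]$ of $L_p$-formulas, where $[\phi]=[\psi]$ iff $\phi\leftrightarrow\psi\in Z$, with order $[\phi]\le[\psi]$ iff $(\phi\rightarrow\psi)\in Z$ and with operations $\vee,\wedge,\neg,\exists x,\forall x$ induced by those on formulas. Equivalently, $[\phi]$ may be identified with the set of assignments of integers to variables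 satisfying $\phi$, with $\le$ being inclusion. The bottom element is the class of unsatisfiable formulas (the empty set of assignments). Approximations. $L_p^{min}$-formulas $\sigma(x,y,z)$, $\pi(x,y,z)$ with three free variables are approximations to the sum and product if $[x+y=z]\le[\sigma(x,y,z)]$ and $[x\cdot y=z]\le[\pi(x,y,z)]$ in $L_p/Z$. Coarse interpretation. Given approximations $\sigma,\pi$ to the sum and product, $\mathfrak{C}=\mathfrak{C}_{\sigma,\pi}$ assigns to formulas elements of $L_p/Z$ as follows (with $x,y,z$ arbitrary variables and $u$ a fresh variable): - $\phi^{\mathfrak{C}}=[\phi]$ for $\phi\in L_p^{min}$; - $(x+y=z)^{\mathfrak{C}}=\left[\bigvee_{0\le a<p}\bigvee_{0\le b<p}\left(R_a(x)\wedge R_b(y)\wedge R_{a+b \bmod p}(z)\right)\right]\wedge[\sigma(x,y,z)]$; - $(x+y<z)^{\mathfrak{C}}=\exists u\left((x+y=u)^{\mathfrak{C}}\wedge[u<z]\right)$; - $(x\cdot y=z)^{\mathfrak{C}}=\left[\bigvee_{0\le a<p}\bigvee_{0\le b<p}\left(R_a(x)\wedge R_b(y)\wedge R_{a\cdot b \bmod p}(z)\right)\right]\wedge[\pi(x,y,z)]$; - $(x\cdot y<z)^{\mathfrak{C}}=\exists u\left((x\cdot y=u)^{\mathfrak{C}}\wedge[u<z]\right)$; - $\mathfrak{C}$ commutes with $\vee,\wedge,\neg,\exists x,\forall x$, e.g. $(\phi\vee\psi)^{\mathfrak{C}}=\phi^{\mathfrak{C}}\vee\psi^{\mathfrak{C}}$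 and $(\exists x\,\phi)^{\mathfrak{C}}=\exists x\,(\phi^{\mathfrak{C}})$. This defines $\phi^{\mathfrak{C}}$ for all formulas built by connectives and quantifiers from atomic $L_p^{min}$-formulas and the four atomic forms $x+y=z$, $x+y<z$, $x\cdot y=z$, $x\cdot y<z$. An arbitrary $L_p$-formula is interpreted by first applying a fixed algorithmic translation into a formula of this kind that is equivalent to it over the standard integers; the translation takes positive formulas to positive formulas and leaves formulas already of this kind unchanged. *)

theory Defs
  imports Main "HOL-Number_Theory.Cong"
begin

section \<open>Syntax and standard interpretation\<close>

datatype tm =
    Var nat
  | Num nat
  | Minus tm
  | Plus tm tm
  | Times tm tm

text \<open>\<^term>\<open>FRes a t\<close> is the atom \<open>R\<^sub>a(t)\<close>. The modulus \<open>p\<close> is a parameter of the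
  semantics, and \<open>a < p\<close> is imposed by \<open>Lp p\<close> below.\<close>

datatype fm =
    FEq tm tm
  | FLess tm tm
  | FRes nat tm
  | FNot fm
  | FOr fm fm
  | FAnd fm fm
  | FEx nat fm
  | FAll nat fm

abbreviation FImp :: "fm \<Rightarrow> fm \<Rightarrow> fm" where
  "FImp \<phi> \<psi> \<equiv> FOr (FNot \<phi>) \<psi>"

abbreviation FIff :: "fm \<Rightarrow> fm \<Rightarrow> fm" where
  "FIff \<phi> \<psi> \<equiv> FAnd (FImp \<phi> \<psi>) (FImp \<psi> \<phi>)"

primrec tvars :: "tm \<Rightarrow> nat set" where
  "tvars (Var x) = {x}"
| "tvars (Num n) = {}"
| "tvars (Minus t) = tvars t"
| "tvars (Plus s t) = tvars s \<union> tvars t"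
| "tvars (Times s t) = tvars s \<union> tvars t"

primrec fvars :: "fm \<Rightarrow> nat set" where
  "fvars (FEq s t) = tvars s \<union> tvars t"
| "fvars (FLess s t) = tvars s \<union> tvars t"
| "fvars (FRes a t) = tvars t"
| "fvars (FNot \<phi>) = fvars \<phi>"
| "fvars (FOr \<phi> \<psi>) = fvars \<phi> \<union> fvars \<psi>"
| "fvars (FAnd \<phi> \<psi>) = fvars \<phi> \<union> fvars \<psi>"
| "fvars (FEx x \<phi>) = fvars \<phi> - {x}"
| "fvars (FAll x \<phi>) = fvars \<phi> - {x}"

primrec residues_below :: "nat \<Rightarrow> fm \<Rightarrow> bool" where
  "residues_below p (FEq s t) \<longleftrightarrow> True"
| "residues_below p (FLess s t) \<longleftrightarrow> True"
| "residues_below p (FRes a t) \<longleftrightarrow> a < p"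
| "residues_below p (FNot \<phi>) \<longleftrightarrow> residues_below p \<phi>"
| "residues_below p (FOr \<phi> \<psi>) \<longleftrightarrow> residues_below p \<phi> \<and> residues_below p \<psi>"
| "residues_below p (FAnd \<phi> \<psi>) \<longleftrightarrow> residues_below p \<phi> \<and> residues_below p \<psi>"
| "residues_below p (FEx x \<phi>) \<longleftrightarrow> residues_below p \<phi>"
| "residues_below p (FAll x \<phi>) \<longleftrightarrow> residues_below p \<phi>"

definition Lp :: "nat \<Rightarrow> fm set" where
  "Lp p = {\<phi>. residues_below p \<phi>}"

primrec min_tm :: "tm \<Rightarrow> bool" where
  "min_tm (Var x) \<longleftrightarrow> True"
| "min_tm (Num n) \<longleftrightarrow> True"
| "min_tm (Minus t) \<longleftrightarrow> min_tm t"
| "min_tm (Plus s t) \<longleftrightarrow> False"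
| "min_tm (Times s t) \<longleftrightarrow> False"

primrec min_fm :: "fm \<Rightarrow> bool" where
  "min_fm (FEq s t) \<longleftrightarrow> min_tm s \<and> min_tm t"
| "min_fm (FLess s t) \<longleftrightarrow> min_tm s \<and> min_tm t"
| "min_fm (FRes a t) \<longleftrightarrow> min_tm t"
| "min_fm (FNot \<phi>) \<longleftrightarrow> min_fm \<phi>"
| "min_fm (FOr \<phi> \<psi>) \<longleftrightarrow> min_fm \<phi> \<and> min_fm \<psi>"
| "min_fm (FAnd \<phi> \<psi>) \<longleftrightarrow> min_fm \<phi> \<and> min_fm \<psi>"
| "min_fm (FEx x \<phi>) \<longleftrightarrow> min_fm \<phi>"
| "min_fm (FAll x \<phi>) \<longleftrightarrow> min_fm \<phi>"

definition Lp_min :: "nat \<Rightarrow> fm set" where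
  "Lp_min p = {\<phi> \<in> Lp p. min_fm \<phi>}"

primrec positive :: "fm \<Rightarrow> bool" where
  "positive (FEq s t) \<longleftrightarrow> True"
| "positive (FLess s t) \<longleftrightarrow> True"
| "positive (FRes a t) \<longleftrightarrow> True"
| "positive (FNot \<phi>) \<longleftrightarrow> False"
| "positive (FOr \<phi> \<psi>) \<longleftrightarrow> positive \<phi> \<and> positive \<psi>"
| "positive (FAnd \<phi> \<psi>) \<longleftrightarrow> positive \<phi> \<and> positive \<psi>"
| "positive (FEx x \<phi>) \<longleftrightarrow> positive \<phi>"
| "positive (FAll x \<phi>) \<longleftrightarrow> positive \<phi>"

definition diophantine_inequality :: "nat \<Rightarrow> fm \<Rightarrow> bool" where
  "diophantine_inequality p \<phi> \<longleftrightarrow> \<phi> \<in> Lp p \<and> positive \<phi>"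

primrec tm_val :: "(nat \<Rightarrow> int) \<Rightarrow> tm \<Rightarrow> int" where
  "tm_val e (Var x) = e x"
| "tm_val e (Num n) = int n"
| "tm_val e (Minus t) = - tm_val e t"
| "tm_val e (Plus s t) = tm_val e s + tm_val e t"
| "tm_val e (Times s t) = tm_val e s * tm_val e t"

primrec sat :: "nat \<Rightarrow> (nat \<Rightarrow> int) \<Rightarrow> fm \<Rightarrow> bool" where
  "sat p e (FEq s t) \<longleftrightarrow> tm_val e s = tm_val e t"
| "sat p e (FLess s t) \<longleftrightarrow> tm_val e s < tm_val e t"
| "sat p e (FRes a t) \<longleftrightarrow> [tm_val e t = int a] (mod int p)"
| "sat p e (FNot \<phi>) \<longleftrightarrow> \<not> sat p e \<phi>"
| "sat p e (FOr \<phi> \<psi>) \<longleftrightarrow> sat p e \<phi> \<or> sat p e \<psi>"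
| "sat p e (FAnd \<phi> \<psi>) \<longleftrightarrow> sat p e \<phi> \<and> sat p e \<psi>"
| "sat p e (FEx x \<phi>) \<longleftrightarrow> (\<exists>n. sat p (e(x := n)) \<phi>)"
| "sat p e (FAll x \<phi>) \<longleftrightarrow> (\<forall>n. sat p (e(x := n)) \<phi>)"


section \<open>The Lindenbaum algebra \<open>L\<^sub>p/Z\<close>\<close>

definition true_fms :: "nat \<Rightarrow> fm set" where
  "true_fms p = {\<phi> \<in> Lp p. \<forall>e. sat p e \<phi>}"

definition lind_rel :: "nat \<Rightarrow> (fm \<times> fm) set" where
  "lind_rel p = {(\<phi>, \<psi>). \<phi> \<in> Lp p \<and> \<psi> \<in> Lp p \<and> FIff \<phi> \<psi> \<in> true_fms p}"

definition cls :: "nat \<Rightarrow> fm \<Rightarrow> fm set" where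
  "cls p \<phi> = lind_rel p `` {\<phi>}"

definition lind :: "nat \<Rightarrow> fm set set" where
  "lind p = Lp p // lind_rel p"

definition lind_le :: "nat \<Rightarrow> fm set \<Rightarrow> fm set \<Rightarrow> bool" where
  "lind_le p X Y \<longleftrightarrow> (\<exists>\<phi>\<in>X. \<exists>\<psi>\<in>Y. FImp \<phi> \<psi> \<in> true_fms p)"

definition lind_or :: "nat \<Rightarrow> fm set \<Rightarrow> fm set \<Rightarrow> fm set" where
  "lind_or p X Y = (\<Union>\<phi>\<in>X. \<Union>\<psi>\<in>Y. cls p (FOr \<phi> \<psi>))"

definition lind_and :: "nat \<Rightarrow> fm set \<Rightarrow> fm set \<Rightarrow> fm set" where
  "lind_and p X Y = (\<Union>\<phi>\<in>X. \<Union>\<psi>\<in>Y. cls p (FAnd \<phi> \<psi>))"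

definition lind_not :: "nat \<Rightarrow> fm set \<Rightarrow> fm set" where
  "lind_not p X = (\<Union>\<phi>\<in>X. cls p (FNot \<phi>))"

definition lind_ex :: "nat \<Rightarrow> nat \<Rightarrow> fm set \<Rightarrow> fm set" where
  "lind_ex p x X = (\<Union>\<phi>\<in>X. cls p (FEx x \<phi>))"

definition lind_all :: "nat \<Rightarrow> nat \<Rightarrow> fm set \<Rightarrow> fm set" where
  "lind_all p x X = (\<Union>\<phi>\<in>X. cls p (FAll x \<phi>))"

definition lind_bot :: "nat \<Rightarrow> fm set" where
  "lind_bot p = {\<phi> \<in> Lp p. \<forall>e. \<not> sat p e \<phi>}"

lemma mem_true_fms_FIff:
  "FIff \<phi> \<psi> \<in> true_fms p \<longleftrightarrow> \<phi> \<in> Lp p \<and> \<psi> \<in> Lp p \<and> (\<forall>e. sat p e \<phi> \<longleftrightarrow> sat p e \<psi>)"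
  by (auto simp: true_fms_def Lp_def)

lemma mem_cls_iff:
  "\<psi> \<in> cls p \<phi> \<longleftrightarrow> \<phi> \<in> Lp p \<and> \<psi> \<in> Lp p \<and> (\<forall>e. sat p e \<phi> \<longleftrightarrow> sat p e \<psi>)"
  unfolding cls_def lind_rel_def Image_singleton_iff mem_Collect_eq case_prod_conv mem_true_fms_FIff
  by blast

lemma equiv_lind_rel: "equiv (Lp p) (lind_rel p)"
  unfolding lind_rel_def mem_true_fms_FIff
  by (auto intro!: equivI refl_onI symI transI)

lemma cls_eq_iff:
  assumes "\<phi> \<in> Lp p" "\<psi> \<in> Lp p"
  shows "cls p \<phi> = cls p \<psi> \<longleftrightarrow> (\<forall>e. sat p e \<phi> \<longleftrightarrow> sat p e \<psi>)"
  using assms by (auto simp: mem_cls_iff set_eq_iff)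

lemma lind_le_cls:
  assumes "\<phi> \<in> Lp p" "\<psi> \<in> Lp p"
  shows "lind_le p (cls p \<phi>) (cls p \<psi>) \<longleftrightarrow> FImp \<phi> \<psi> \<in> true_fms p"
proof
  assume "lind_le p (cls p \<phi>) (cls p \<psi>)"
  then show "FImp \<phi> \<psi> \<in> true_fms p"
    using assms by (auto simp: lind_le_def mem_cls_iff true_fms_def Lp_def)
next
  assume "FImp \<phi> \<psi> \<in> true_fms p"
  moreover have "\<phi> \<in> cls p \<phi>" "\<psi> \<in> cls p \<psi>"
    using assms by (simp_all add: mem_cls_iff)
  ultimately show "lind_le p (cls p \<phi>) (cls p \<psi>)"
    unfolding lind_le_def by blast
qed

lemma lind_ops_cls:
  assumes "\<phi> \<in> Lp p"
  shows "\<psi> \<in> Lp p \<Longrightarrow> lind_or p (cls p \<phi>) (cls p \<psi>) = cls p (FOr \<phi> \<psi>)"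
    and "\<psi> \<in> Lp p \<Longrightarrow> lind_and p (cls p \<phi>) (cls p \<psi>) = cls p (FAnd \<phi> \<psi>)"
    and "lind_not p (cls p \<phi>) = cls p (FNot \<phi>)"
    and "lind_ex p x (cls p \<phi>) = cls p (FEx x \<phi>)"
    and "lind_all p x (cls p \<phi>) = cls p (FAll x \<phi>)"
proof -
  have self: "\<phi> \<in> cls p \<phi>" using assms by (simp add: mem_cls_iff)
  show "lind_or p (cls p \<phi>) (cls p \<psi>) = cls p (FOr \<phi> \<psi>)" if "\<psi> \<in> Lp p"
  proof -
    have "\<psi> \<in> cls p \<psi>" using that by (simp add: mem_cls_iff)
    moreover have "cls p (FOr \<phi>' \<psi>') = cls p (FOr \<phi> \<psi>)"
      if "\<phi>' \<in> cls p \<phi>" "\<psi>' \<in> cls p \<psi>" for \<phi>' \<psi>'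
      using that by (subst cls_eq_iff) (auto simp: mem_cls_iff Lp_def)
    ultimately show ?thesis using self unfolding lind_or_def by blast
  qed
  show "lind_and p (cls p \<phi>) (cls p \<psi>) = cls p (FAnd \<phi> \<psi>)" if "\<psi> \<in> Lp p"
  proof -
    have "\<psi> \<in> cls p \<psi>" using that by (simp add: mem_cls_iff)
    moreover have "cls p (FAnd \<phi>' \<psi>') = cls p (FAnd \<phi> \<psi>)"
      if "\<phi>' \<in> cls p \<phi>" "\<psi>' \<in> cls p \<psi>" for \<phi>' \<psi>'
      using that by (subst cls_eq_iff) (auto simp: mem_cls_iff Lp_def)
    ultimately show ?thesis using self unfolding lind_and_def by blast
  qed
  have "cls p (FNot \<phi>') = cls p (FNot \<phi>)" "cls p (FEx x \<phi>') = cls p (FEx x \<phi>)"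
    "cls p (FAll x \<phi>') = cls p (FAll x \<phi>)" if "\<phi>' \<in> cls p \<phi>" for \<phi>'
    using that by (subst cls_eq_iff; auto simp: mem_cls_iff Lp_def)+
  then show "lind_not p (cls p \<phi>) = cls p (FNot \<phi>)" "lind_ex p x (cls p \<phi>) = cls p (FEx x \<phi>)"
    "lind_all p x (cls p \<phi>) = cls p (FAll x \<phi>)"
    using self unfolding lind_not_def lind_ex_def lind_all_def by blast+
qed

lemma lind_bot_least:
  "lind_bot p \<in> lind p" "X \<in> lind p \<Longrightarrow> lind_le p (lind_bot p) X"
proof -
  have f: "FLess (Num 0) (Num 0) \<in> Lp p" by (simp add: Lp_def)
  have "lind_bot p = cls p (FLess (Num 0) (Num 0))"
    using f by (auto simp: lind_bot_def mem_cls_iff)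
  then show "lind_bot p \<in> lind p"
    using f by (simp add: lind_def cls_def quotientI)
  assume "X \<in> lind p"
  then obtain \<phi> where "\<phi> \<in> Lp p" "X = cls p \<phi>"
    by (auto simp: lind_def cls_def elim: quotientE)
  then show "lind_le p (lind_bot p) X"
    using f \<open>lind_bot p = _\<close> by (auto simp: lind_le_cls true_fms_def Lp_def)
qed


section \<open>Renaming of free variables\<close>

definition fresh :: "nat set \<Rightarrow> nat" where
  "fresh A = (LEAST n. n \<notin> A)"

primrec tm_rename :: "(nat \<Rightarrow> nat) \<Rightarrow> tm \<Rightarrow> tm" where
  "tm_rename f (Var x) = Var (f x)"
| "tm_rename f (Num n) = Num n"
| "tm_rename f (Minus t) = Minus (tm_rename f t)"
| "tm_rename f (Plus s t) = Plus (tm_rename f s) (tm_rename f t)"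
| "tm_rename f (Times s t) = Times (tm_rename f s) (tm_rename f t)"

text \<open>Capture-avoiding: bound variables are renamed away from the images of the free ones.\<close>

primrec rename :: "(nat \<Rightarrow> nat) \<Rightarrow> fm \<Rightarrow> fm" where
  "rename f (FEq s t) = FEq (tm_rename f s) (tm_rename f t)"
| "rename f (FLess s t) = FLess (tm_rename f s) (tm_rename f t)"
| "rename f (FRes a t) = FRes a (tm_rename f t)"
| "rename f (FNot \<phi>) = FNot (rename f \<phi>)"
| "rename f (FOr \<phi> \<psi>) = FOr (rename f \<phi>) (rename f \<psi>)"
| "rename f (FAnd \<phi> \<psi>) = FAnd (rename f \<phi>) (rename f \<psi>)"
| "rename f (FEx x \<phi>) =
     (let w = fresh (f ` (fvars \<phi> - {x})) in FEx w (rename (f(x := w)) \<phi>))"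
| "rename f (FAll x \<phi>) =
     (let w = fresh (f ` (fvars \<phi> - {x})) in FAll w (rename (f(x := w)) \<phi>))"

text \<open>A formula \<open>\<sigma>(x, y, z)\<close> with three distinguished variables is given with
  \<open>Var 0\<close>, \<open>Var 1\<close>, \<open>Var 2\<close> in these roles.\<close>

definition inst3 :: "fm \<Rightarrow> nat \<Rightarrow> nat \<Rightarrow> nat \<Rightarrow> fm" where
  "inst3 \<sigma> x y z = rename (\<lambda>i. if i = 0 then x else if i = 1 then y else z) \<sigma>"

lemma finite_tvars: "finite (tvars t)"
  by (induction t) auto

lemma finite_fvars: "finite (fvars \<phi>)"
  by (induction \<phi>) (auto simp: finite_tvars)

lemma fresh_notin: "finite A \<Longrightarrow> fresh A \<notin> A"
  unfolding fresh_def by (rule LeastI_ex) (simp add: ex_new_if_finite)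

lemma tm_val_cong: "(\<And>x. x \<in> tvars t \<Longrightarrow> e x = e' x) \<Longrightarrow> tm_val e t = tm_val e' t"
  by (induction t) auto

lemma tm_val_upd: "x \<notin> tvars t \<Longrightarrow> tm_val (e(x := n)) t = tm_val e t"
  by (rule tm_val_cong) auto

lemma sat_cong: "(\<And>x. x \<in> fvars \<phi> \<Longrightarrow> e x = e' x) \<Longrightarrow> sat p e \<phi> \<longleftrightarrow> sat p e' \<phi>"
proof (induction \<phi> arbitrary: e e')
  case (FEq s t)
  have "tm_val e s = tm_val e' s" "tm_val e t = tm_val e' t"
    by (rule tm_val_cong, rule FEq, simp)+
  then show ?case by simp
next
  case (FLess s t)
  have "tm_val e s = tm_val e' s" "tm_val e t = tm_val e' t"
    by (rule tm_val_cong, rule FLess, simp)+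
  then show ?case by simp
next
  case (FRes a t)
  have "tm_val e t = tm_val e' t"
    by (rule tm_val_cong, rule FRes, simp)
  then show ?case by simp
next
  case (FNot \<phi>)
  have "sat p e \<phi> \<longleftrightarrow> sat p e' \<phi>"
    by (rule FNot.IH, rule FNot.prems, simp)
  then show ?case by simp
next
  case (FOr \<phi> \<psi>)
  have "sat p e \<phi> \<longleftrightarrow> sat p e' \<phi>"
    by (rule FOr.IH(1), rule FOr.prems, simp)
  moreover have "sat p e \<psi> \<longleftrightarrow> sat p e' \<psi>"
    by (rule FOr.IH(2), rule FOr.prems, simp)
  ultimately show ?case by simp
next
  case (FAnd \<phi> \<psi>)
  have "sat p e \<phi> \<longleftrightarrow> sat p e' \<phi>"
    by (rule FAnd.IH(1), rule FAnd.prems, simp)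
  moreover have "sat p e \<psi> \<longleftrightarrow> sat p e' \<psi>"
    by (rule FAnd.IH(2), rule FAnd.prems, simp)
  ultimately show ?case by simp
next
  case (FEx x \<phi>)
  have "sat p (e(x := n)) \<phi> \<longleftrightarrow> sat p (e'(x := n)) \<phi>" for n
    by (rule FEx.IH) (simp add: FEx.prems)
  then show ?case by simp
next
  case (FAll x \<phi>)
  have "sat p (e(x := n)) \<phi> \<longleftrightarrow> sat p (e'(x := n)) \<phi>" for n
    by (rule FAll.IH) (simp add: FAll.prems)
  then show ?case by simp
qed

lemma tm_val_rename: "tm_val e (tm_rename f t) = tm_val (e \<circ> f) t"
  by (induction t) auto

lemma sat_rename: "sat p e (rename f \<phi>) \<longleftrightarrow> sat p (e \<circ> f) \<phi>"
proof (induction \<phi> arbitrary: e f)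
  case (FEx x \<phi>)
  define w where "w = fresh (f ` (fvars \<phi> - {x}))"
  have w: "w \<notin> f ` (fvars \<phi> - {x})"
    unfolding w_def by (rule fresh_notin) (simp add: finite_fvars)
  have "sat p (e(w := n) \<circ> f(x := w)) \<phi> \<longleftrightarrow> sat p ((e \<circ> f)(x := n)) \<phi>" for n
    by (rule sat_cong) (use w in auto)
  then show ?case
    unfolding rename.simps Let_def w_def[symmetric] sat.simps FEx.IH by blast
next
  case (FAll x \<phi>)
  define w where "w = fresh (f ` (fvars \<phi> - {x}))"
  have w: "w \<notin> f ` (fvars \<phi> - {x})"
    unfolding w_def by (rule fresh_notin) (simp add: finite_fvars)
  have "sat p (e(w := n) \<circ> f(x := w)) \<phi> \<longleftrightarrow> sat p ((e \<circ> f)(x := n)) \<phi>" for n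
    by (rule sat_cong) (use w in auto)
  then show ?case
    unfolding rename.simps Let_def w_def[symmetric] sat.simps FAll.IH by blast
qed (simp_all add: tm_val_rename)

lemma rename_Lp: "rename f \<phi> \<in> Lp p \<longleftrightarrow> \<phi> \<in> Lp p"
proof -
  have "residues_below p (rename f \<phi>) \<longleftrightarrow> residues_below p \<phi>"
    by (induction \<phi> arbitrary: f) (simp_all add: Let_def)
  then show ?thesis by (simp add: Lp_def)
qed


section \<open>Approximations and the coarse interpretation\<close>

definition sum_approximation :: "nat \<Rightarrow> fm \<Rightarrow> bool" where
  "sum_approximation p \<sigma> \<longleftrightarrow> \<sigma> \<in> Lp_min p \<and> fvars \<sigma> \<subseteq> {0, 1, 2} \<and>
     lind_le p (cls p (FEq (Plus (Var 0) (Var 1)) (Var 2))) (cls p \<sigma>)"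

definition product_approximation :: "nat \<Rightarrow> fm \<Rightarrow> bool" where
  "product_approximation p \<pi> \<longleftrightarrow> \<pi> \<in> Lp_min p \<and> fvars \<pi> \<subseteq> {0, 1, 2} \<and>
     lind_le p (cls p (FEq (Times (Var 0) (Var 1)) (Var 2))) (cls p \<pi>)"

text \<open>The language has no constant for falsity; \<open>0 < 0\<close> is the empty disjunction.\<close>

definition FDisj :: "fm list \<Rightarrow> fm" where
  "FDisj \<phi>s = foldr FOr \<phi>s (FLess (Num 0) (Num 0))"

definition residue_fm :: "nat \<Rightarrow> (nat \<Rightarrow> nat \<Rightarrow> nat) \<Rightarrow> nat \<Rightarrow> nat \<Rightarrow> nat \<Rightarrow> fm" where
  "residue_fm p op x y z =
     FDisj (map (\<lambda>a. FDisj (map (\<lambda>b.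
       FAnd (FRes a (Var x)) (FAnd (FRes b (Var y)) (FRes (op a b mod p) (Var z))))
       [0..<p])) [0..<p])"

definition coarse_sum :: "nat \<Rightarrow> fm \<Rightarrow> nat \<Rightarrow> nat \<Rightarrow> nat \<Rightarrow> fm set" where
  "coarse_sum p \<sigma> x y z = lind_and p (cls p (residue_fm p (+) x y z)) (cls p (inst3 \<sigma> x y z))"

definition coarse_product :: "nat \<Rightarrow> fm \<Rightarrow> nat \<Rightarrow> nat \<Rightarrow> nat \<Rightarrow> fm set" where
  "coarse_product p \<pi> x y z = lind_and p (cls p (residue_fm p (*) x y z)) (cls p (inst3 \<pi> x y z))"

definition coarse_eq :: "nat \<Rightarrow> fm \<Rightarrow> fm \<Rightarrow> tm \<Rightarrow> tm \<Rightarrow> fm set" where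
  "coarse_eq p \<sigma> \<pi> s t = (case (s, t) of
     (Plus (Var x) (Var y), Var z) \<Rightarrow> coarse_sum p \<sigma> x y z
   | (Times (Var x) (Var y), Var z) \<Rightarrow> coarse_product p \<pi> x y z
   | _ \<Rightarrow> cls p (FEq s t))"

definition coarse_less :: "nat \<Rightarrow> fm \<Rightarrow> fm \<Rightarrow> tm \<Rightarrow> tm \<Rightarrow> fm set" where
  "coarse_less p \<sigma> \<pi> s t = (case (s, t) of
     (Plus (Var x) (Var y), Var z) \<Rightarrow>
       (let u = fresh {x, y, z} in
         lind_ex p u (lind_and p (coarse_sum p \<sigma> x y u) (cls p (FLess (Var u) (Var z)))))
   | (Times (Var x) (Var y), Var z) \<Rightarrow>
       (let u = fresh {x, y, z} in
         lind_ex p u (lind_and p (coarse_product p \<pi> x y u) (cls p (FLess (Var u) (Var z)))))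
   | _ \<Rightarrow> cls p (FLess s t))"

text \<open>Flat formulas are those built from atomic formulas of \<open>Lp_min p\<close> and the atoms
  \<open>x + y = z\<close>, \<open>x + y < z\<close>, \<open>x \<cdot> y = z\<close>, \<open>x \<cdot> y < z\<close>. Only on these is
  \<open>coarse_flat\<close> meaningful; on other atoms it has a dummy value, which \<open>coarse\<close>
  below never uses.\<close>

definition flat_pair :: "tm \<Rightarrow> tm \<Rightarrow> bool" where
  "flat_pair s t \<longleftrightarrow> min_tm s \<and> min_tm t \<or>
     (\<exists>x y z. (s = Plus (Var x) (Var y) \<or> s = Times (Var x) (Var y)) \<and> t = Var z)"

primrec flat_fm :: "fm \<Rightarrow> bool" where
  "flat_fm (FEq s t) \<longleftrightarrow> flat_pair s t"
| "flat_fm (FLess s t) \<longleftrightarrow> flat_pair s t"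
| "flat_fm (FRes a t) \<longleftrightarrow> min_tm t"
| "flat_fm (FNot \<phi>) \<longleftrightarrow> flat_fm \<phi>"
| "flat_fm (FOr \<phi> \<psi>) \<longleftrightarrow> flat_fm \<phi> \<and> flat_fm \<psi>"
| "flat_fm (FAnd \<phi> \<psi>) \<longleftrightarrow> flat_fm \<phi> \<and> flat_fm \<psi>"
| "flat_fm (FEx x \<phi>) \<longleftrightarrow> flat_fm \<phi>"
| "flat_fm (FAll x \<phi>) \<longleftrightarrow> flat_fm \<phi>"

definition Lp_flat :: "nat \<Rightarrow> fm set" where
  "Lp_flat p = {\<phi> \<in> Lp p. flat_fm \<phi>}"

primrec coarse_flat :: "nat \<Rightarrow> fm \<Rightarrow> fm \<Rightarrow> fm \<Rightarrow> fm set" where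
  "coarse_flat p \<sigma> \<pi> (FEq s t) = coarse_eq p \<sigma> \<pi> s t"
| "coarse_flat p \<sigma> \<pi> (FLess s t) = coarse_less p \<sigma> \<pi> s t"
| "coarse_flat p \<sigma> \<pi> (FRes a t) = cls p (FRes a t)"
| "coarse_flat p \<sigma> \<pi> (FNot \<phi>) = lind_not p (coarse_flat p \<sigma> \<pi> \<phi>)"
| "coarse_flat p \<sigma> \<pi> (FOr \<phi> \<psi>) = lind_or p (coarse_flat p \<sigma> \<pi> \<phi>) (coarse_flat p \<sigma> \<pi> \<psi>)"
| "coarse_flat p \<sigma> \<pi> (FAnd \<phi> \<psi>) = lind_and p (coarse_flat p \<sigma> \<pi> \<phi>) (coarse_flat p \<sigma> \<pi> \<psi>)"
| "coarse_flat p \<sigma> \<pi> (FEx x \<phi>) = lind_ex p x (coarse_flat p \<sigma> \<pi> \<phi>)"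
| "coarse_flat p \<sigma> \<pi> (FAll x \<phi>) = lind_all p x (coarse_flat p \<sigma> \<pi> \<phi>)"

text \<open>The clause for \<open>Lp_min p\<close>, which overlaps with the recursion above, is a consequence:\<close>

lemma coarse_flat_min:
  assumes "\<phi> \<in> Lp_min p"
  shows "coarse_flat p \<sigma> \<pi> \<phi> = cls p \<phi>"
proof -
  have "min_fm \<phi> \<Longrightarrow> \<phi> \<in> Lp p \<Longrightarrow> coarse_flat p \<sigma> \<pi> \<phi> = cls p \<phi>"
    by (induction \<phi>)
      (auto simp: Lp_def lind_ops_cls coarse_eq_def coarse_less_def split: tm.split)
  then show ?thesis using assms by (simp add: Lp_min_def)
qed

text \<open>The translation into flat formulas is kept as a parameter \<open>T\<close>, subject to the following
  requirements. Lemma \<open>translation_exists\<close> shows that they can be met.\<close>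

definition translation :: "nat \<Rightarrow> (fm \<Rightarrow> fm) \<Rightarrow> bool" where
  "translation p T \<longleftrightarrow> (\<forall>\<phi>\<in>Lp p.
     T \<phi> \<in> Lp_flat p \<and>
     (\<forall>e. sat p e (T \<phi>) \<longleftrightarrow> sat p e \<phi>) \<and>
     (positive \<phi> \<longrightarrow> positive (T \<phi>)) \<and>
     (\<phi> \<in> Lp_flat p \<longrightarrow> T \<phi> = \<phi>))"

definition coarse :: "nat \<Rightarrow> (fm \<Rightarrow> fm) \<Rightarrow> fm \<Rightarrow> fm \<Rightarrow> fm \<Rightarrow> fm set" where
  "coarse p T \<sigma> \<pi> \<phi> = coarse_flat p \<sigma> \<pi> (T \<phi>)"


subsection \<open>A translation\<close>

text \<open>\<open>graph_fm t z\<close> is a flat positive formula expressing \<open>t = z\<close>.\<close>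

primrec graph_fm :: "tm \<Rightarrow> nat \<Rightarrow> fm" where
  "graph_fm (Var x) z = FEq (Var x) (Var z)"
| "graph_fm (Num n) z = FEq (Num n) (Var z)"
| "graph_fm (Minus t) z =
     (let u = fresh (insert z (tvars t))
      in FEx u (FAnd (graph_fm t u) (FEq (Minus (Var u)) (Var z))))"
| "graph_fm (Plus s t) z =
     (let A = insert z (tvars s \<union> tvars t); u = fresh A; v = fresh (insert u A)
      in FEx u (FEx v (FAnd (FAnd (graph_fm s u) (graph_fm t v))
           (FEq (Plus (Var u) (Var v)) (Var z)))))"
| "graph_fm (Times s t) z =
     (let A = insert z (tvars s \<union> tvars t); u = fresh A; v = fresh (insert u A)
      in FEx u (FEx v (FAnd (FAnd (graph_fm s u) (graph_fm t v))
           (FEq (Times (Var u) (Var v)) (Var z)))))"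

definition flatten_rel :: "(tm \<Rightarrow> tm \<Rightarrow> fm) \<Rightarrow> tm \<Rightarrow> tm \<Rightarrow> fm" where
  "flatten_rel R s t = (if flat_pair s t then R s t else
     (let A = tvars s \<union> tvars t; u = fresh A; v = fresh (insert u A)
      in FEx u (FEx v (FAnd (FAnd (graph_fm s u) (graph_fm t v)) (R (Var u) (Var v))))))"

primrec flatten :: "fm \<Rightarrow> fm" where
  "flatten (FEq s t) = flatten_rel FEq s t"
| "flatten (FLess s t) = flatten_rel FLess s t"
| "flatten (FRes a t) = (if min_tm t then FRes a t else
     (let u = fresh (tvars t) in FEx u (FAnd (graph_fm t u) (FRes a (Var u)))))"
| "flatten (FNot \<phi>) = FNot (flatten \<phi>)"
| "flatten (FOr \<phi> \<psi>) = FOr (flatten \<phi>) (flatten \<psi>)"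
| "flatten (FAnd \<phi> \<psi>) = FAnd (flatten \<phi>) (flatten \<psi>)"
| "flatten (FEx x \<phi>) = FEx x (flatten \<phi>)"
| "flatten (FAll x \<phi>) = FAll x (flatten \<phi>)"

lemma fresh_pair:
  assumes "finite A" "u = fresh A" "v = fresh (insert u A)"
  shows "u \<notin> A" "v \<notin> A" "u \<noteq> v"
  using fresh_notin[of A] fresh_notin[of "insert u A"] assms by auto

lemma sat_graph_fm: "sat p e (graph_fm t z) \<longleftrightarrow> tm_val e t = e z"
proof (induction t arbitrary: e z)
  case (Minus t)
  define u where "u = fresh (insert z (tvars t))"
  have "u \<notin> insert z (tvars t)"
    unfolding u_def by (rule fresh_notin) (simp add: finite_tvars)
  then have "tm_val (e(u := n)) t = tm_val e t" "(e(u := n)) u = n" "(e(u := n)) z = e z" for n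
    by (simp_all add: tm_val_upd)
  then show ?case
    unfolding graph_fm.simps Let_def u_def[symmetric] sat.simps Minus.IH tm_val.simps
    by metis
next
  case (Plus s t)
  define A where "A = insert z (tvars s \<union> tvars t)"
  define u where "u = fresh A"
  define v where "v = fresh (insert u A)"
  have "u \<notin> A" "v \<notin> A" "u \<noteq> v"
    using fresh_pair[OF _ u_def v_def] by (simp_all add: A_def finite_tvars)
  then have "tm_val (e(u := m, v := n)) s = tm_val e s" "tm_val (e(u := m, v := n)) t = tm_val e t"
    "(e(u := m, v := n)) u = m" "(e(u := m, v := n)) v = n" "(e(u := m, v := n)) z = e z" for m n
    by (simp_all add: A_def tm_val_upd)
  then show ?case
    unfolding graph_fm.simps Let_def A_def[symmetric] u_def[symmetric] v_def[symmetric]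
      sat.simps Plus.IH tm_val.simps
    by metis
next
  case (Times s t)
  define A where "A = insert z (tvars s \<union> tvars t)"
  define u where "u = fresh A"
  define v where "v = fresh (insert u A)"
  have "u \<notin> A" "v \<notin> A" "u \<noteq> v"
    using fresh_pair[OF _ u_def v_def] by (simp_all add: A_def finite_tvars)
  then have "tm_val (e(u := m, v := n)) s = tm_val e s" "tm_val (e(u := m, v := n)) t = tm_val e t"
    "(e(u := m, v := n)) u = m" "(e(u := m, v := n)) v = n" "(e(u := m, v := n)) z = e z" for m n
    by (simp_all add: A_def tm_val_upd)
  then show ?case
    unfolding graph_fm.simps Let_def A_def[symmetric] u_def[symmetric] v_def[symmetric]
      sat.simps Times.IH tm_val.simps
    by metis
qed simp_all

lemma graph_fm_shape:
  "positive (graph_fm t z)" "flat_fm (graph_fm t z)" "residues_below p (graph_fm t z)"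
  by (induction t arbitrary: z) (auto simp: Let_def flat_pair_def)

lemma sat_flatten_rel:
  assumes "R = FEq \<or> R = FLess"
  shows "sat p e (flatten_rel R s t) \<longleftrightarrow> sat p e (R s t)"
proof -
  define A where "A = tvars s \<union> tvars t"
  define u where "u = fresh A"
  define v where "v = fresh (insert u A)"
  have "u \<notin> A" "v \<notin> A" "u \<noteq> v"
    using fresh_pair[OF _ u_def v_def] by (simp_all add: A_def finite_tvars)
  then show ?thesis
    using assms unfolding flatten_rel_def Let_def A_def[symmetric] u_def[symmetric] v_def[symmetric]
    by (auto simp: A_def sat_graph_fm tm_val_upd)
qed

lemma sat_flatten: "sat p e (flatten \<phi>) \<longleftrightarrow> sat p e \<phi>"
proof (induction \<phi> arbitrary: e)
  case (FRes a t)
  have "fresh (tvars t) \<notin> tvars t"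
    by (rule fresh_notin) (simp add: finite_tvars)
  then show ?case by (auto simp: Let_def sat_graph_fm tm_val_upd)
qed (simp_all add: sat_flatten_rel)

lemma translation_exists: "\<exists>T. translation p T"
proof -
  have "flat_fm (flatten \<phi>)" for \<phi>
    by (induction \<phi>) (auto simp: flatten_rel_def Let_def graph_fm_shape, auto simp: flat_pair_def)
  moreover have "residues_below p \<phi> \<Longrightarrow> residues_below p (flatten \<phi>)" for \<phi>
    by (induction \<phi>) (auto simp: flatten_rel_def Let_def graph_fm_shape)
  moreover have "positive \<phi> \<Longrightarrow> positive (flatten \<phi>)" for \<phi>
    by (induction \<phi>) (auto simp: flatten_rel_def Let_def graph_fm_shape)
  moreover have "flat_fm \<phi> \<Longrightarrow> flatten \<phi> = \<phi>" for \<phi>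
    by (induction \<phi>) (auto simp: flatten_rel_def)
  ultimately have "translation p flatten"
    by (simp add: translation_def Lp_flat_def Lp_def sat_flatten)
  then show ?thesis by (rule exI[where x = flatten])
qed

end

(* The coarse clause for each atom x + y = z or x * y = z is implied by the standard one: the
   residue part because reduction mod p is a ring homomorphism, the rest by the definition of an
   approximation. All positive connectives are monotone, so a standard solution of a positive
   formula satisfies its coarse interpretation. *)

theory Submission
  imports Defs
begin

text \<open>This is the order of the Lindenbaum algebra between the class of \<open>\<phi>\<close>
  and \<open>X\<close>, stated through a representative \<open>\<psi>\<close>. The representative
  lets \<open>lind_ops_cls\<close> evaluate the algebra operations, and it records that
  \<open>X\<close> really is a class.\<close>

definition implies_cls :: "nat \<Rightarrow> fm \<Rightarrow> fm set \<Rightarrow> bool" where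
  "implies_cls p \<phi> X \<longleftrightarrow> (\<exists>\<psi>\<in>Lp p. X = cls p \<psi> \<and> (\<forall>e. sat p e \<phi> \<longrightarrow> sat p e \<psi>))"

lemma implies_clsI:
  assumes "\<psi> \<in> Lp p" "\<And>e. sat p e \<phi> \<Longrightarrow> sat p e \<psi>"
  shows "implies_cls p \<phi> (cls p \<psi>)"
  using assms by (auto simp: implies_cls_def)

lemma implies_clsE:
  assumes "implies_cls p \<phi> X"
  obtains \<psi> where "\<psi> \<in> Lp p" "X = cls p \<psi>" "\<And>e. sat p e \<phi> \<Longrightarrow> sat p e \<psi>"
  using assms by (auto simp: implies_cls_def)

lemma implies_cls_mono:
  assumes "implies_cls p \<psi> X" "\<And>e. sat p e \<phi> \<Longrightarrow> sat p e \<psi>"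
  shows "implies_cls p \<phi> X"
  using assms by (auto simp: implies_cls_def)

lemma implies_cls_or:
  assumes "implies_cls p \<phi> X" "implies_cls p \<psi> Y"
  shows "implies_cls p (FOr \<phi> \<psi>) (lind_or p X Y)"
  using assms
  by (elim implies_clsE) (auto simp: lind_ops_cls Lp_def intro!: implies_clsI)

lemma implies_cls_and:
  assumes "implies_cls p \<phi> X" "implies_cls p \<psi> Y"
  shows "implies_cls p (FAnd \<phi> \<psi>) (lind_and p X Y)"
  using assms
  by (elim implies_clsE) (auto simp: lind_ops_cls Lp_def intro!: implies_clsI)

lemma implies_cls_ex:
  assumes "implies_cls p \<phi> X"
  shows "implies_cls p (FEx x \<phi>) (lind_ex p x X)"
  using assms
  by (elim implies_clsE) (auto simp: lind_ops_cls Lp_def intro!: implies_clsI, blast)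

lemma implies_cls_all:
  assumes "implies_cls p \<phi> X"
  shows "implies_cls p (FAll x \<phi>) (lind_all p x X)"
  using assms
  by (elim implies_clsE) (auto simp: lind_ops_cls Lp_def intro!: implies_clsI)

lemma sat_FDisj: "sat p e (FDisj \<phi>s) \<longleftrightarrow> (\<exists>\<phi>\<in>set \<phi>s. sat p e \<phi>)"
  by (induction \<phi>s) (auto simp: FDisj_def)

lemma residues_below_FDisj:
  "residues_below p (FDisj \<phi>s) \<longleftrightarrow> (\<forall>\<phi>\<in>set \<phi>s. residues_below p \<phi>)"
  by (induction \<phi>s) (auto simp: FDisj_def)

lemma residue_fm_Lp: "residue_fm p op x y z \<in> Lp p"
  by (auto simp: Lp_def residue_fm_def residues_below_FDisj)

lemma sat_residue_fm:
  "sat p e (residue_fm p op x y z) \<longleftrightarrow> (\<exists>a<p. \<exists>b<p. [e x = int a] (mod int p) \<and>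
     [e y = int b] (mod int p) \<and> [e z = int (op a b mod p)] (mod int p))"
  by (simp add: residue_fm_def sat_FDisj Bex_def) blast

text \<open>One argument for sum and product: \<open>iop\<close> is the operation on integers,
  \<open>op\<close> its counterpart on naturals, and the second hypothesis says that they agree
  modulo \<open>p\<close>.\<close>

lemma sat_residue_fm_hom:
  assumes "p > 0"
    and "\<And>a b c d. [a = int c] (mod int p) \<Longrightarrow> [b = int d] (mod int p) \<Longrightarrow>
           [iop a b = int (op c d)] (mod int p)"
    and "e z = iop (e x) (e y)"
  shows "sat p e (residue_fm p op x y z)"
proof -
  \<comment> \<open>The canonical residues of \<open>e x\<close> and \<open>e y\<close> pick the
    true disjunct. Since \<open>p > 0\<close>, they are nonnegative, so passing through
    \<open>nat\<close> loses nothing.\<close>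
  define a where "a = nat (e x mod int p)"
  define b where "b = nat (e y mod int p)"
  have ab: "a < p" "b < p" "[e x = int a] (mod int p)" "[e y = int b] (mod int p)"
    using \<open>p > 0\<close> by (simp_all add: a_def b_def nat_less_iff cong_def)
  then have "[e z = int (op a b mod p)] (mod int p)"
    using assms(2)[OF ab(3,4)] assms(3) by (simp add: cong_def zmod_int)
  with ab show ?thesis unfolding sat_residue_fm by blast
qed

lemma implies_cls_sum:
  assumes "p > 0" "sum_approximation p \<sigma>"
  shows "implies_cls p (FEq (Plus (Var x) (Var y)) (Var z)) (coarse_sum p \<sigma> x y z)"
proof -
  have \<sigma>: "\<sigma> \<in> Lp p" "\<And>e. e 0 + e 1 = e 2 \<Longrightarrow> sat p e \<sigma>"
    using assms(2) by (auto simp: sum_approximation_def Lp_min_def lind_le_cls true_fms_def Lp_def)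
  have "sat p e (residue_fm p (+) x y z)" if "e x + e y = e z" for e
    using assms(1) that
    by (intro sat_residue_fm_hom[where iop = "(+)"]) (auto simp: cong_add)
  \<comment> \<open>By \<open>sat_rename\<close>, this is satisfaction of \<open>\<sigma>\<close>
    under the assignment giving \<open>e x\<close>, \<open>e y\<close>, \<open>e z\<close> to the
    variables 0, 1, 2. The approximation property applies to it even if \<open>x\<close>,
    \<open>y\<close>, \<open>z\<close> coincide.\<close>
  moreover have "sat p e (inst3 \<sigma> x y z)" if "e x + e y = e z" for e
    using \<sigma>(2) that by (simp add: inst3_def sat_rename)
  moreover have "inst3 \<sigma> x y z \<in> Lp p"
    using \<sigma>(1) by (simp add: inst3_def rename_Lp)
  ultimately show ?thesis
    unfolding coarse_sum_def
    using residue_fm_Lp[of p "(+)" x y z] by (auto simp: lind_ops_cls Lp_def intro!: implies_clsI)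
qed

lemma implies_cls_product:
  assumes "p > 0" "product_approximation p \<pi>"
  shows "implies_cls p (FEq (Times (Var x) (Var y)) (Var z)) (coarse_product p \<pi> x y z)"
proof -
  have \<pi>: "\<pi> \<in> Lp p" "\<And>e. e 0 * e 1 = e 2 \<Longrightarrow> sat p e \<pi>"
    using assms(2)
    by (auto simp: product_approximation_def Lp_min_def lind_le_cls true_fms_def Lp_def)
  have "sat p e (residue_fm p (*) x y z)" if "e x * e y = e z" for e
    using assms(1) that
    by (intro sat_residue_fm_hom[where iop = "(*)"]) (auto simp: cong_mult)
  moreover have "sat p e (inst3 \<pi> x y z)" if "e x * e y = e z" for e
    using \<pi>(2) that by (simp add: inst3_def sat_rename)
  moreover have "inst3 \<pi> x y z \<in> Lp p"
    using \<pi>(1) by (simp add: inst3_def rename_Lp)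
  ultimately show ?thesis
    unfolding coarse_product_def
    using residue_fm_Lp[of p "(*)" x y z] by (auto simp: lind_ops_cls Lp_def intro!: implies_clsI)
qed

text \<open>For fresh \<open>u\<close>, the atom \<open>t < z\<close> implies that some
  \<open>u\<close> satisfies \<open>t = u\<close> and \<open>u < z\<close>, with the value of
  \<open>t\<close> as witness. Monotonicity then reduces the strict coarse atoms to the coarse
  equations.\<close>

lemma implies_cls_less_via_eq:
  assumes "implies_cls p (FEq t (Var u)) X" "u \<notin> tvars t" "u \<noteq> z"
  shows "implies_cls p (FLess t (Var z)) (lind_ex p u (lind_and p X (cls p (FLess (Var u) (Var z)))))"
proof (rule implies_cls_mono)
  show "implies_cls p (FEx u (FAnd (FEq t (Var u)) (FLess (Var u) (Var z))))
    (lind_ex p u (lind_and p X (cls p (FLess (Var u) (Var z)))))"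
    by (intro implies_cls_ex implies_cls_and assms(1) implies_clsI) (auto simp: Lp_def)
qed (use assms(2,3) in \<open>simp add: tm_val_upd\<close>)

lemma implies_cls_coarse_eq:
  assumes "p > 0" "sum_approximation p \<sigma>" "product_approximation p \<pi>"
  shows "implies_cls p (FEq s t) (coarse_eq p \<sigma> \<pi> s t)"
proof -
  have "implies_cls p (FEq s t) (cls p (FEq s t))" for s t
    by (rule implies_clsI) (simp_all add: Lp_def)
  then show ?thesis
    using implies_cls_sum[OF assms(1,2)] implies_cls_product[OF assms(1,3)]
    by (simp add: coarse_eq_def split: tm.split)
qed

lemma implies_cls_coarse_less:
  assumes "p > 0" "sum_approximation p \<sigma>" "product_approximation p \<pi>"
  shows "implies_cls p (FLess s t) (coarse_less p \<sigma> \<pi> s t)"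
proof -
  have base: "implies_cls p (FLess s t) (cls p (FLess s t))" for s t
    by (rule implies_clsI) (simp_all add: Lp_def)
  \<comment> \<open>The bound variable chosen by \<open>coarse_less\<close> meets the freshness
    conditions of \<open>implies_cls_less_via_eq\<close>.\<close>
  have "fresh {x, y, z} \<notin> {x, y, z}" for x y z
    by (rule fresh_notin) simp
  then have "fresh {x, y, z} \<noteq> x" "fresh {x, y, z} \<noteq> y" "fresh {x, y, z} \<noteq> z" for x y z
    by blast+
  then show ?thesis
    using implies_cls_less_via_eq[OF implies_cls_sum[OF assms(1,2)]]
      implies_cls_less_via_eq[OF implies_cls_product[OF assms(1,3)]] base
    by (simp add: coarse_less_def Let_def split: tm.split)
qed

text \<open>Induction on \<open>\<phi>\<close>: each positive connective and quantifier preserves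
  the order. Negation would reverse it, and \<open>positive\<close> rules that case out.\<close>

lemma implies_cls_coarse_flat:
  assumes "p > 0" "sum_approximation p \<sigma>" "product_approximation p \<pi>"
    and "positive \<phi>" "\<phi> \<in> Lp p"
  shows "implies_cls p \<phi> (coarse_flat p \<sigma> \<pi> \<phi>)"
  using assms(4,5)
proof (induction \<phi>)
  case (FRes a t)
  then show ?case by (auto intro: implies_clsI)
qed (simp_all add: assms(1-3) implies_cls_coarse_eq implies_cls_coarse_less implies_cls_or
  implies_cls_and implies_cls_ex implies_cls_all Lp_def)

theorem mainTheorem3:
  fixes p :: nat and T :: "fm \<Rightarrow> fm" and \<phi> :: fm
  assumes "p \<ge> 2"
    and "translation p T"
    and "diophantine_inequality p \<phi>"
    and "\<exists>\<sigma> \<pi>. sum_approximation p \<sigma> \<and> product_approximation p \<pi> \<and>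
           coarse p T \<sigma> \<pi> \<phi> = lind_bot p"
  shows "\<not> (\<exists>e :: nat \<Rightarrow> int. sat p e \<phi>)"
proof -
  obtain \<sigma> \<pi> where approx: "sum_approximation p \<sigma>" "product_approximation p \<pi>"
    and bot: "coarse_flat p \<sigma> \<pi> (T \<phi>) = lind_bot p"
    using assms(4) by (auto simp: coarse_def)
  have T: "T \<phi> \<in> Lp p" "positive (T \<phi>)" "\<And>e. sat p e (T \<phi>) \<longleftrightarrow> sat p e \<phi>"
    using assms(2,3) by (auto simp: translation_def diophantine_inequality_def Lp_flat_def)
  have "implies_cls p (T \<phi>) (lind_bot p)"
    using implies_cls_coarse_flat[OF _ approx T(2,1)] assms(1) bot by simp
  then obtain \<psi> where "\<psi> \<in> Lp p" "lind_bot p = cls p \<psi>" "\<And>e. sat p e (T \<phi>) \<Longrightarrow> sat p e \<psi>"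
    unfolding implies_cls_def by blast
  \<comment> \<open>A representative lies in its own class, so \<open>\<psi>\<close> is
    unsatisfiable. A solution of \<open>\<phi>\<close> would satisfy \<open>T \<phi>\<close> and
    hence \<open>\<psi>\<close>.\<close>
  moreover from this have "\<psi> \<in> lind_bot p"
    by (simp add: mem_cls_iff)
  ultimately show ?thesis
    using T(3) by (auto simp: lind_bot_def)
qed

end
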